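(* Let $k$ be a field of characteristic different from $2$ and let $L$ be a Lie algebra over $k$ that is generated as a Lie algebra by the set $E$ of its nonzero extremal elements. For $x\in E$ let $f_x:L\to k$ be the linear functional with $[x,[x,y]]=f_x(y)x$ for all $y\in L$. Then there is a unique bilinear symmetric form $f:L\times L\to k$ such that, for each $x\in E$, the linear form $f_x$ coincides with $y\mapsto f(x,y)$. This form is associative, in the sense that $f(x,[y,z])=f([x,y],z)$ for all $x,y,z\in L$.
   Context: An element $x\in L$ is extremal if $[x,[x,y]]\in kx$ for all $y\in L$. For nonzero extremal $x$, the functional $f_x$ is uniquely determined by $[x,[x,y]]=f_x(y)x$. *)

theory Defs
  imports Complex_Main
begin

definition bilinear_map ::
    "('k::field \<Rightarrow> 'a::ab_group_add \<Rightarrow> 'a) \<Rightarrow> ('k \<Rightarrow> 'b::ab_group_add \<Rightarrow> 'b) \<Rightarrow> ('a \<Rightarrow> 'a \<Rightarrow> 'b) \<Rightarrow> bool"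
  where "bilinear_map s t \<beta> \<longleftrightarrow>
    (\<forall>x. Vector_Spaces.linear s t (\<lambda>y. \<beta> x y)) \<and> (\<forall>y. Vector_Spaces.linear s t (\<lambda>x. \<beta> x y))"

text \<open>The whole type \<open>'l\<close> is the underlying space of the Lie algebra; no restriction is made on
  the characteristic or on the dimension.\<close>

locale lie_algebra = vector_space scale
  for scale :: "'k::field \<Rightarrow> 'l::ab_group_add \<Rightarrow> 'l" (infixr \<open>*s\<close> 75) +
  fixes bracket :: "'l \<Rightarrow> 'l \<Rightarrow> 'l"
  assumes bilinear: "bilinear_map scale scale bracket"
    and alternating: "bracket x x = 0"
    and jacobi: "bracket x (bracket y z) + bracket y (bracket z x) + bracket z (bracket x y) = 0"
begin

definition lie_subalgebra :: "'l set \<Rightarrow> bool"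
  where "lie_subalgebra S \<longleftrightarrow> subspace S \<and> (\<forall>x\<in>S. \<forall>y\<in>S. bracket x y \<in> S)"

definition lie_generated :: "'l set \<Rightarrow> 'l set"
  where "lie_generated S = lie_subalgebra hull S"

definition extremal :: "'l \<Rightarrow> bool"
  where "extremal x \<longleftrightarrow> (\<forall>y. \<exists>c. bracket x (bracket x y) = c *s x)"

definition extremal_set :: "'l set"
  where "extremal_set = {x. extremal x \<and> x \<noteq> 0}"

text \<open>The functional \<open>f\<^sub>x\<close> attached to a nonzero extremal element \<open>x\<close>; it is unspecified for
  other \<open>x\<close>. Existence and uniqueness are established below.\<close>

definition extremal_functional :: "'l \<Rightarrow> 'l \<Rightarrow> 'k"
  where "extremal_functional x =
    (THE \<phi>. Vector_Spaces.linear scale (*) \<phi> \<and> (\<forall>y. bracket x (bracket x y) = \<phi> y *s x))"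

lemma extremal_functional_ex1:
  assumes "x \<in> extremal_set"
  shows "\<exists>!\<phi>. Vector_Spaces.linear scale (*) \<phi> \<and> (\<forall>y. bracket x (bracket x y) = \<phi> y *s x)"
proof -
  have ext: "\<forall>y. \<exists>c. bracket x (bracket x y) = c *s x" and nz: "x \<noteq> 0"
    using assms by (simp_all add: extremal_set_def extremal_def)
  from ext obtain \<phi> where \<phi>: "\<And>y. bracket x (bracket x y) = \<phi> y *s x" by metis
  have lin: "Vector_Spaces.linear scale scale (bracket x)"
    using bilinear unfolding bilinear_map_def by blast
  have add: "bracket x (u + v) = bracket x u + bracket x v"
    and scl: "bracket x (c *s u) = c *s bracket x u" for u v c
    using lin unfolding Vector_Spaces.linear_iff by blast+
  have "\<phi> (u + v) *s x = (\<phi> u + \<phi> v) *s x" for u v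
    unfolding scale_left_distrib \<phi>[symmetric] add ..
  then have 1: "\<phi> (u + v) = \<phi> u + \<phi> v" for u v
    using nz scale_right_imp_eq by blast
  have "\<phi> (c *s u) *s x = (c * \<phi> u) *s x" for c u
    unfolding scale_scale[symmetric] \<phi>[symmetric] scl ..
  then have 2: "\<phi> (c *s u) = c * \<phi> u" for c u
    using nz scale_right_imp_eq by blast
  have "vector_space ((*) :: 'k \<Rightarrow> 'k \<Rightarrow> 'k)"
    by unfold_locales (simp_all add: algebra_simps)
  with vector_space_axioms 1 2 have "Vector_Spaces.linear scale (*) \<phi>"
    unfolding Vector_Spaces.linear_iff by blast
  moreover have "\<psi> = \<phi>" if "\<forall>y. bracket x (bracket x y) = \<psi> y *s x" for \<psi>
  proof
    show "\<psi> y = \<phi> y" for y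
      using that \<phi>[of y] nz scale_right_imp_eq by metis
  qed
  ultimately show ?thesis
    using \<phi> by blast
qed

lemma extremal_functional:
  assumes "x \<in> extremal_set"
  shows "Vector_Spaces.linear scale (*) (extremal_functional x)"
    and "bracket x (bracket x y) = extremal_functional x y *s x"
  using theI'[OF extremal_functional_ex1[OF assms]] unfolding extremal_functional_def by blast+

definition symmetric_bilinear_form :: "('l \<Rightarrow> 'l \<Rightarrow> 'k) \<Rightarrow> bool"
  where "symmetric_bilinear_form f \<longleftrightarrow> bilinear_map scale (*) f \<and> (\<forall>x y. f x y = f y x)"

definition associative_form :: "('l \<Rightarrow> 'l \<Rightarrow> 'k) \<Rightarrow> bool"
  where "associative_form f \<longleftrightarrow> (\<forall>x y z. f x (bracket y z) = f (bracket x y) z)"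

end

end

theory Submission
  imports Defs
begin

text \<open>
  The argument rests on the automorphisms \<open>exp (ad x) = 1 + ad x + (ad x)\<^sup>2 / 2\<close> attached to the
  extremal elements \<open>x\<close>; higher terms of the series vanish because \<open>(ad x)\<^sup>3 = 0\<close>, and since only
  \<open>2\<close> has to be inverted, characteristic \<open>3\<close> needs no separate treatment.

  An automorphism permutes the set \<open>E\<close> of nonzero extremal elements and transports the functionals
  \<open>f\<^sub>x\<close>. For \<open>x, y \<in> E\<close> the element \<open>exp (ad x) y = y + [x, y] + f\<^sub>x(y) x / 2\<close> is therefore again in
  \<open>E\<close>, whence \<open>[x, y]\<close> lies in the linear span of \<open>E\<close>. So this span is a subalgebra, and \<open>E\<close>, which
  generates \<open>L\<close> as a Lie algebra, already spans it as a vector space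
  (\<open>span_extremal_set\<close>). Uniqueness of the form is then immediate.

  For existence, evaluating \<open>[x, [y, [x, y]]]\<close> in two ways yields \<open>f\<^sub>x(y) = f\<^sub>y(x)\<close> on \<open>E\<close>
  (\<open>extremal_functional_commute\<close>). Choose a basis \<open>B \<subseteq> E\<close> and extend \<open>b \<mapsto> f\<^sub>b(y)\<close> linearly
  from \<open>B\<close> to \<open>L\<close>. The reciprocity law shows that the form so obtained gives the right functional
  at every element of \<open>E\<close> and not only at the elements of \<open>B\<close>, and that it is symmetric.

  For associativity, the form is invariant under \<open>exp (ad y)\<close> and \<open>exp (ad (- y))\<close> for each
  \<open>y \<in> E\<close>. Subtracting the two invariance identities isolates the terms of odd degree in
  \<open>ad y\<close>; those of degree \<open>3\<close> vanish because \<open>f\<^sub>y\<close> vanishes on \<open>[y, L]\<close>, and what remains is twice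
  the infinitesimal invariance \<open>f([y, u], v) + f(u, [y, v]) = 0\<close>. As \<open>E\<close> spans \<open>L\<close>, this holds
  for all \<open>y\<close> and is associativity.
\<close>

lemma two_neq_zero_of_CHAR:
  assumes "CHAR('k::field) \<noteq> 2"
  shows "(2::'k) \<noteq> 0"
proof
  assume "(2::'k) = 0"
  then have "of_nat 2 = (0::'k)"
    by simp
  then have "CHAR('k) dvd 2"
    by (simp only: of_nat_eq_0_iff_char_dvd)
  then have "CHAR('k) \<le> 2" and "CHAR('k) \<noteq> 0"
    using dvd_imp_le[of "CHAR('k)" 2] by (simp, intro notI, simp)
  moreover have "CHAR('k) \<noteq> 1"
    using CHAR_not_1 by auto
  ultimately show False
    using assms by linarith
qed

context lie_algebra
begin

section \<open>Bracket arithmetic\<close>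

lemma bracket_add_right: "bracket x (y + z) = bracket x y + bracket x z"
  and bracket_add_left: "bracket (x + y) z = bracket x z + bracket y z"
  and bracket_scale_right: "bracket x (c *s y) = c *s bracket x y"
  and bracket_scale_left: "bracket (c *s x) y = c *s bracket x y"
  using bilinear unfolding bilinear_map_def Vector_Spaces.linear_iff by blast+

lemma bracket_zero_left [simp]: "bracket 0 y = 0"
  using bracket_add_left[of 0 0 y] by simp

lemma bracket_zero_right [simp]: "bracket x 0 = 0"
  using bracket_add_right[of x 0 0] by simp

lemma bracket_minus_right: "bracket x (- y) = - bracket x y"
  using bracket_add_right[of x y "- y"] by (simp add: eq_neg_iff_add_eq_0 add.commute)

lemma bracket_minus_left: "bracket (- x) y = - bracket x y"
  using bracket_add_left[of x "- x" y] by (simp add: eq_neg_iff_add_eq_0 add.commute)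

lemma bracket_anticommute: "bracket y x = - bracket x y"
proof -
  have "bracket (x + y) (x + y) = 0"
    by (rule alternating)
  then have "bracket x y + bracket y x = 0"
    unfolding bracket_add_left bracket_add_right alternating[of x] alternating[of y] by (simp add: add.commute)
  then show ?thesis
    by (simp add: eq_neg_iff_add_eq_0 add.commute)
qed

lemma bracket_derivation:
  "bracket x (bracket y z) = bracket (bracket x y) z + bracket y (bracket x z)"
proof -
  have "bracket y (bracket z x) = - bracket y (bracket x z)"
    by (simp add: bracket_anticommute[of z x] bracket_minus_right)
  moreover have "bracket z (bracket x y) = - bracket (bracket x y) z"
    by (rule bracket_anticommute)
  ultimately show ?thesis
    using jacobi[of x y z] by (simp add: algebra_simps)
qed

section \<open>Extremal functionals\<close>

lemma extremal_functional_add: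
    "x \<in> extremal_set \<Longrightarrow>
      extremal_functional x (u + v) = extremal_functional x u + extremal_functional x v"
  and extremal_functional_scale:
    "x \<in> extremal_set \<Longrightarrow> extremal_functional x (c *s u) = c * extremal_functional x u"
  using extremal_functional(1)[of x] unfolding Vector_Spaces.linear_iff by blast+

lemma extremal_functional_unique:
  assumes "x \<in> extremal_set" and "bracket x (bracket x y) = c *s x"
  shows "extremal_functional x y = c"
proof -
  have "x \<noteq> 0"
    using assms(1) by (simp add: extremal_set_def)
  then show ?thesis
    using assms extremal_functional(2)[OF assms(1), of y] by simp
qed

lemma uminus_extremal_set:
  assumes "x \<in> extremal_set"
  shows "- x \<in> extremal_set"
proof -
  have "bracket (- x) (bracket (- x) y) = (- extremal_functional x y) *s (- x)" for y
    using extremal_functional(2)[OF assms, of y]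
    by (simp add: bracket_minus_left bracket_minus_right)
  then have "extremal (- x)"
    unfolding extremal_def by blast
  then show ?thesis
    using assms by (simp add: extremal_set_def)
qed

text \<open>This is \<open>(ad x)\<^sup>3 = 0\<close>, read off from the coefficient of \<open>x\<close>.\<close>

lemma extremal_functional_bracket_self:
  assumes "x \<in> extremal_set"
  shows "extremal_functional x (bracket x y) = 0"
  by (rule extremal_functional_unique[OF assms])
     (simp add: extremal_functional(2)[OF assms] bracket_scale_right alternating)

text \<open>Since \<open>[[x, y], [x, y]] = 0\<close>, the operators \<open>ad x\<close> and \<open>ad y\<close> commute on \<open>[x, y]\<close>. One order
  of application produces \<open>f\<^sub>x(y)\<close> as a coefficient of \<open>[y, x]\<close>, the other one \<open>f\<^sub>y(x)\<close>. If
  \<open>[x, y] = 0\<close>, both values are zero.\<close>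

lemma extremal_functional_commute:
  assumes x: "x \<in> extremal_set" and y: "y \<in> extremal_set"
  shows "extremal_functional x y = extremal_functional y x"
proof (cases "bracket x y = 0")
  case True
  then have "bracket y x = 0"
    by (simp add: bracket_anticommute[of y x])
  then have "extremal_functional x y = 0" "extremal_functional y x = 0"
    using True by (auto intro!: extremal_functional_unique x y)
  then show ?thesis
    by simp
next
  case False
  have "bracket y (bracket x (bracket x y)) = bracket x (bracket y (bracket x y))"
    using bracket_derivation[of x y "bracket x y"] by (simp add: alternating)
  moreover have "bracket y (bracket x (bracket x y)) = extremal_functional x y *s bracket y x"
    by (simp add: extremal_functional(2)[OF x] bracket_scale_right)
  moreover have "bracket x (bracket y (bracket x y)) = extremal_functional y x *s bracket y x"
    unfolding bracket_anticommute[of x y] bracket_minus_right extremal_functional(2)[OF y]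
      bracket_scale_right by (simp add: bracket_anticommute[of y x])
  ultimately show ?thesis
    using False by (simp add: bracket_anticommute[of y x])
qed

section \<open>Exponentials of extremal elements\<close>

text \<open>The exponential series of \<open>ad x\<close> is cut after the quadratic term, beyond which all powers of
  \<open>ad x\<close> vanish when \<open>x\<close> is extremal.\<close>

definition exp_ad :: "'l \<Rightarrow> 'l \<Rightarrow> 'l"
  where "exp_ad x y = y + bracket x y + (1 / 2) *s bracket x (bracket x y)"

lemma scale_half_double:
  assumes "(2::'k) \<noteq> 0"
  shows "(1 / 2) *s (v + v) = v"
proof -
  have "(1 / 2) *s (v + v) = (1 / 2 + 1 / 2 :: 'k) *s v"
    by (simp only: scale_left_distrib scale_right_distrib)
  also have "1 / 2 + 1 / 2 = (1 :: 'k)"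
    using assms by (simp add: field_simps)
  finally show ?thesis
    by simp
qed

lemma exp_ad_extremal:
  assumes "x \<in> extremal_set"
  shows "exp_ad x y = y + bracket x y + (extremal_functional x y / 2) *s x"
  by (simp add: exp_ad_def extremal_functional(2)[OF assms])

lemma exp_ad_scale: "exp_ad x (c *s y) = c *s exp_ad x y"
  by (simp add: exp_ad_def bracket_scale_right scale_right_distrib mult.commute)

text \<open>The composite is \<open>1 + (ad x)\<^sup>4 / 4\<close>, and \<open>(ad x)\<^sup>3 = 0\<close>.\<close>

lemma exp_ad_inverse:
  assumes two: "(2::'k) \<noteq> 0" and x: "x \<in> extremal_set"
  shows "exp_ad x (exp_ad (- x) y) = y"
proof -
  define a where "a = extremal_functional x y"
  have xxy: "bracket x (bracket x y) = a *s x"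
    by (simp add: a_def extremal_functional(2)[OF x])
  have 1: "exp_ad (- x) y = y - bracket x y + (a / 2) *s x"
    by (simp add: exp_ad_def bracket_minus_left bracket_minus_right xxy)
  have 2: "bracket x (exp_ad (- x) y) = bracket x y - a *s x"
    unfolding 1 by (simp add: bracket_add_right bracket_minus_right bracket_scale_right alternating
        xxy diff_conv_add_uminus del: add_uminus_conv_diff)
  have 3: "bracket x (bracket x y - a *s x) = a *s x"
    by (simp add: bracket_add_right bracket_minus_right bracket_scale_right alternating
        xxy diff_conv_add_uminus del: add_uminus_conv_diff)
  have "(a / 2) *s x + (a / 2) *s x = a *s x"
    using scale_half_double[OF two, of "a *s x"] by (simp add: scale_right_distrib)
  then show ?thesis
    unfolding exp_ad_def[of x] 2 3 unfolding 1 by (simp add: algebra_simps)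
qed

text \<open>The product of \<open>exp (ad x) y\<close> and \<open>exp (ad x) z\<close> agrees with \<open>exp (ad x) [y, z]\<close> up to the
  cubic terms \<open>([(ad x) y, (ad x)\<^sup>2 z] + [(ad x)\<^sup>2 y, (ad x) z]) / 2\<close>, which cancel because both
  brackets are \<open>f\<^sub>x(y) f\<^sub>x(z) x\<close> up to opposite signs, and the quartic term
  \<open>[(ad x)\<^sup>2 y, (ad x)\<^sup>2 z] / 4\<close>, a multiple of \<open>[x, x]\<close>. Deducing the cancellation from
  \<open>(ad x)\<^sup>3 = 0\<close> alone would cost a division by \<open>3\<close>.\<close>

lemma exp_ad_bracket:
  assumes two: "(2::'k) \<noteq> 0" and x: "x \<in> extremal_set"
  shows "exp_ad x (bracket y z) = bracket (exp_ad x y) (exp_ad x z)"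
proof -
  define a b where "a = extremal_functional x y" and "b = extremal_functional x z"
  define p q where "p = bracket x y" and "q = bracket x z"
  have xp: "bracket x p = a *s x" and xq: "bracket x q = b *s x"
    by (simp_all add: a_def b_def p_def q_def extremal_functional(2)[OF x])
  have px: "bracket p x = - (a *s x)" and yx: "bracket y x = - p"
    using bracket_anticommute[of p x] bracket_anticommute[of y x] xp p_def by simp_all
  have 1: "bracket x (bracket y z) = bracket p z + bracket y q"
    unfolding p_def q_def by (rule bracket_derivation)
  have "bracket x (bracket p z) = a *s q + bracket p q"
    using bracket_derivation[of x p z] by (simp add: xp bracket_scale_left q_def)
  moreover have "bracket x (bracket y q) = bracket p q - b *s p"
    using bracket_derivation[of x y q] by (simp add: xq bracket_scale_right yx p_def)
  ultimately have 2: "bracket x (bracket p z + bracket y q) =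
      (bracket p q + bracket p q) + (a *s q - b *s p)"
    by (simp add: bracket_add_right)
  have lhs: "exp_ad x (bracket y z) =
      bracket y z + (bracket p z + bracket y q) + (bracket p q + ((a / 2) *s q - (b / 2) *s p))"
    unfolding exp_ad_def 1 2 scale_right_distrib[of _ "bracket p q + bracket p q"]
      scale_half_double[OF two]
    by (simp add: scale_right_diff_distrib)
  have ey: "exp_ad x y = y + p + (a / 2) *s x" and ez: "exp_ad x z = z + q + (b / 2) *s x"
    by (simp_all add: exp_ad_extremal[OF x] a_def b_def p_def q_def)
  show ?thesis
    unfolding lhs ey ez
    by (simp add: bracket_add_left bracket_add_right bracket_scale_left bracket_scale_right
        alternating px yx xq q_def[symmetric] algebra_simps)
qed

lemma exp_ad_extremal_set:
  assumes two: "(2::'k) \<noteq> 0" and x: "x \<in> extremal_set" and y: "y \<in> extremal_set"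
  shows "exp_ad x y \<in> extremal_set"
    and "extremal_functional (exp_ad x y) (exp_ad x z) = extremal_functional y z"
proof -
  have *: "bracket (exp_ad x y) (bracket (exp_ad x y) (exp_ad x z)) =
      extremal_functional y z *s exp_ad x y" for z
    by (simp add: exp_ad_bracket[OF two x, symmetric] extremal_functional(2)[OF y] exp_ad_scale)
  have ext: "bracket (exp_ad x y) (bracket (exp_ad x y) w) =
      extremal_functional y (exp_ad (- x) w) *s exp_ad x y" for w
    using *[of "exp_ad (- x) w"] by (simp add: exp_ad_inverse[OF two x])
  have "exp_ad (- x) (exp_ad x y) = y"
    using exp_ad_inverse[OF two uminus_extremal_set[OF x]] by simp
  moreover have "exp_ad (- x) 0 = 0"
    by (simp add: exp_ad_def)
  moreover have "y \<noteq> 0"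
    using y by (simp add: extremal_set_def)
  ultimately have "exp_ad x y \<noteq> 0"
    by metis
  then show "exp_ad x y \<in> extremal_set"
    using ext unfolding extremal_set_def extremal_def by blast
  then show "extremal_functional (exp_ad x y) (exp_ad x z) = extremal_functional y z"
    using * by (rule extremal_functional_unique)
qed

section \<open>Linear spanning by extremal elements\<close>

lemma bracket_extremal_in_span:
  assumes two: "(2::'k) \<noteq> 0" and x: "x \<in> extremal_set" and y: "y \<in> extremal_set"
  shows "bracket x y \<in> span extremal_set"
proof -
  have "bracket x y = exp_ad x y - y - (extremal_functional x y / 2) *s x"
    by (simp add: exp_ad_extremal[OF x])
  then show ?thesis
    using exp_ad_extremal_set(1)[OF assms] x y
    by (simp add: span_base span_diff span_scale)
qed

lemma lie_subalgebra_span: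
  assumes "\<And>x y. x \<in> S \<Longrightarrow> y \<in> S \<Longrightarrow> bracket x y \<in> span S"
  shows "lie_subalgebra (span S)"
proof -
  have *: "bracket x v \<in> span S" if "x \<in> S" "v \<in> span S" for x v
    using that(2)
    by (induction rule: span_induct_alt)
       (simp_all add: bracket_add_right bracket_scale_right span_zero span_add span_scale
          assms that(1))
  have "bracket u v \<in> span S" if "u \<in> span S" "v \<in> span S" for u v
    using that(1)
    by (induction rule: span_induct_alt)
       (simp_all add: bracket_add_left bracket_scale_left span_zero span_add span_scale
          * that(2))
  then show ?thesis
    by (simp add: lie_subalgebra_def)
qed

lemma span_extremal_set:
  assumes "(2::'k) \<noteq> 0" and "lie_generated extremal_set = UNIV"
  shows "span extremal_set = UNIV"
proof -
  have "lie_subalgebra (span extremal_set)"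
    by (intro lie_subalgebra_span bracket_extremal_in_span assms)
  then have "lie_generated extremal_set \<subseteq> span extremal_set"
    unfolding lie_generated_def by (intro hull_minimal span_superset)
  then show ?thesis
    using assms(2) by auto
qed

section \<open>Construction of the form\<close>

lemma vector_space_field: "vector_space ((*) :: 'k \<Rightarrow> 'k \<Rightarrow> 'k)"
  by unfold_locales (simp_all add: algebra_simps)

lemma linear_form_eq:
  assumes "Vector_Spaces.linear scale (*) (\<phi> :: 'l \<Rightarrow> 'k)" "Vector_Spaces.linear scale (*) \<psi>"
    and "span S = UNIV" and "\<And>x. x \<in> S \<Longrightarrow> \<phi> x = \<psi> x"
  shows "\<phi> v = \<psi> v"
proof -
  interpret K: vector_space_pair scale "(*) :: 'k \<Rightarrow> 'k \<Rightarrow> 'k"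
    using vector_space_axioms vector_space_field by (rule vector_space_pair.intro)
  show ?thesis
    using K.linear_eq_on[OF assms(1,2), of v S] assms(3,4) by auto
qed

text \<open>A linear extension of \<open>b \<mapsto> f\<^sub>b(y)\<close> from a basis \<open>B \<subseteq> E\<close> depends linearly on \<open>y\<close> as well.
  Its value at an arbitrary \<open>x \<in> E\<close> is checked against \<open>f\<^sub>x\<close> on the basis elements \<open>c\<close>, where
  reciprocity turns both \<open>f\<^sub>b(c)\<close> and \<open>f\<^sub>x(c)\<close> into values of the single linear form \<open>f\<^sub>c\<close>.\<close>

lemma extremal_form_exists:
  assumes span: "span extremal_set = UNIV"
  obtains f where "symmetric_bilinear_form f"
    and "\<And>x y. x \<in> extremal_set \<Longrightarrow> f x y = extremal_functional x y"
proof -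
  interpret K: vector_space_pair scale "(*) :: 'k \<Rightarrow> 'k \<Rightarrow> 'k"
    using vector_space_axioms vector_space_field by (rule vector_space_pair.intro)
  obtain B where B: "B \<subseteq> extremal_set" "independent B" "extremal_set \<subseteq> span B"
    using maximal_independent_subset by metis
  have spanB: "span B = UNIV"
    using B(3) span span_mono[of extremal_set "span B"] by (auto simp: span_span)
  define f where "f x y = K.construct B (\<lambda>b. extremal_functional b y) x" for x y
  have lin1: "Vector_Spaces.linear scale (*) (\<lambda>x. f x y)" for y
    unfolding f_def using B(2) by (rule K.linear_construct)
  have f_basis: "f b y = extremal_functional b y" if "b \<in> B" for b y
    unfolding f_def using B(2) that by (rule K.construct_basis)
  have lin2: "Vector_Spaces.linear scale (*) (f x)" for x
  proof -
    have "f x (u + v) = f x u + f x v" for u v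
      by (rule linear_form_eq[OF lin1 K.linear_compose_add[OF lin1 lin1] spanB])
         (use B(1) in \<open>auto simp: f_basis extremal_functional_add\<close>)
    moreover have "f x (c *s u) = c * f x u" for c u
      by (rule linear_form_eq[OF lin1 K.linear_compose_scale_right[OF lin1] spanB])
         (use B(1) in \<open>auto simp: f_basis extremal_functional_scale\<close>)
    ultimately show ?thesis
      using vector_space_axioms vector_space_field unfolding Vector_Spaces.linear_iff by blast
  qed
  have f_ext: "f x y = extremal_functional x y" if x: "x \<in> extremal_set" for x y
  proof (rule linear_form_eq[OF lin2 extremal_functional(1)[OF x] spanB])
    fix c assume "c \<in> B"
    then have c: "c \<in> extremal_set"
      using B(1) by blast
    have "f x c = extremal_functional c x"
    proof (rule linear_form_eq[OF lin1 extremal_functional(1)[OF c] spanB])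
      show "f b c = extremal_functional c b" if "b \<in> B" for b
        using that c B(1) f_basis extremal_functional_commute by auto
    qed
    also have "\<dots> = extremal_functional x c"
      by (rule extremal_functional_commute[OF c x])
    finally show "f x c = extremal_functional x c" .
  qed
  have "f x y = f y x" for x y
  proof (rule linear_form_eq[OF lin1 lin2 span])
    fix x assume x: "x \<in> extremal_set"
    show "f x y = f y x"
      by (rule linear_form_eq[OF lin2 lin1 span])
         (simp add: x f_ext extremal_functional_commute)
  qed
  then have "symmetric_bilinear_form f"
    using lin1 lin2 unfolding symmetric_bilinear_form_def bilinear_map_def by blast
  then show ?thesis
    using f_ext that by blast
qed

section \<open>Associativity\<close>

text \<open>For \<open>u \<in> E\<close> both sides are values of functionals \<open>f\<^sub>x\<close> with \<open>x \<in> E\<close>, and the automorphism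
  \<open>exp (ad y)\<close> carries the functional of \<open>u\<close> to that of its image.\<close>

lemma extremal_form_exp_ad:
  assumes two: "(2::'k) \<noteq> 0" and "y \<in> extremal_set" "u \<in> extremal_set"
    and f_ext: "\<And>x z. x \<in> extremal_set \<Longrightarrow> f x z = extremal_functional x z"
  shows "f (exp_ad y u) (exp_ad y v) = f u v"
  using exp_ad_extremal_set[OF assms(1-3)] assms(3) by (simp add: f_ext)

text \<open>With \<open>p = [y, u]\<close> and \<open>q = [y, v]\<close>, passing from \<open>y\<close> to \<open>- y\<close> changes the signs of \<open>p\<close> and \<open>q\<close>
  in the exponentials and leaves the quadratic terms alone. The difference of the two invariance
  identities thus keeps \<open>2 (f(p, v) + f(u, q))\<close> and terms containing \<open>f(p, y)\<close> or \<open>f(y, q)\<close>, which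
  are zero.\<close>

lemma extremal_form_infinitesimal_invariance:
  assumes two: "(2::'k) \<noteq> 0" and form: "symmetric_bilinear_form f"
    and f_ext: "\<And>x z. x \<in> extremal_set \<Longrightarrow> f x z = extremal_functional x z"
    and y: "y \<in> extremal_set" and u: "u \<in> extremal_set"
  shows "f (bracket y u) v + f u (bracket y v) = 0"
proof -
  have add: "f (a + b) c = f a c + f b c" "f a (b + c) = f a b + f a c"
    and scl: "f (r *s a) c = r * f a c" "f a (r *s c) = r * f a c"
    and sym: "f a c = f c a" for a b c r
    using form unfolding symmetric_bilinear_form_def bilinear_map_def Vector_Spaces.linear_iff
    by blast+
  have minus: "f (- a) c = - f a c" "f a (- c) = - f a c" for a c
    using scl(1)[of "-1" a c] scl(2)[of a "-1" c] by simp_all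
  define p q where "p = bracket y u" and "q = bracket y v"
  define a b where "a = extremal_functional y u / 2" and "b = extremal_functional y v / 2"
  have cubic: "f y p = 0" "f y q = 0"
    using extremal_functional_bracket_self[OF y] by (simp_all add: f_ext[OF y] p_def q_def)
  then have cubic': "f p y = 0" "f q y = 0"
    by (simp_all add: sym[of p] sym[of q])
  have pos: "exp_ad y u = u + p + a *s y" "exp_ad y v = v + q + b *s y"
    by (simp_all add: exp_ad_extremal[OF y] p_def q_def a_def b_def)
  have neg: "exp_ad (- y) u = u + - p + a *s y" "exp_ad (- y) v = v + - q + b *s y"
    by (simp_all add: exp_ad_def bracket_minus_left bracket_minus_right extremal_functional(2)[OF y]
        p_def q_def a_def b_def)
  have "f (u + p + a *s y) (v + q + b *s y) = f u v"
    using extremal_form_exp_ad[OF two y u f_ext, of v] by (simp add: pos)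
  moreover have "f (u + - p + a *s y) (v + - q + b *s y) = f u v"
    using extremal_form_exp_ad[OF two uminus_extremal_set[OF y] u f_ext, of v] by (simp add: neg)
  ultimately have "f (u + p + a *s y) (v + q + b *s y) - f (u + - p + a *s y) (v + - q + b *s y) = 0"
    by simp
  then have "2 * (f p v + f u q) = 0"
    unfolding add scl minus cubic cubic' by (simp add: algebra_simps)
  then have "f p v + f u q = 0"
    using two by (simp only: mult_eq_0_iff) simp
  then show ?thesis
    by (simp only: p_def q_def)
qed

lemma extremal_form_associative:
  assumes two: "(2::'k) \<noteq> 0" and span: "span extremal_set = UNIV"
    and form: "symmetric_bilinear_form f"
    and f_ext: "\<And>x z. x \<in> extremal_set \<Longrightarrow> f x z = extremal_functional x z"
  shows "associative_form f"
proof -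
  interpret K: vector_space_pair scale "(*) :: 'k \<Rightarrow> 'k \<Rightarrow> 'k"
    using vector_space_axioms vector_space_field by (rule vector_space_pair.intro)
  have lin: "Vector_Spaces.linear scale (*) (\<lambda>u. f u v)" "Vector_Spaces.linear scale (*) (f v)" for v
    using form unfolding symmetric_bilinear_form_def bilinear_map_def by blast+
  have ad: "Vector_Spaces.linear scale scale (bracket v)"
    "Vector_Spaces.linear scale scale (\<lambda>u. bracket u v)" for v
    using bilinear unfolding bilinear_map_def by blast+
  have *: "f x (bracket y z) = f (bracket x y) z"
    if x: "x \<in> extremal_set" and y: "y \<in> extremal_set" for x y z
  proof -
    have "f (bracket x y) z = - f (bracket y x) z"
      using K.linear_neg[OF lin(1)] by (simp add: bracket_anticommute[of x y])
    then show ?thesis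
      using extremal_form_infinitesimal_invariance[OF two form f_ext y x, of z]
      by (simp add: add_eq_0_iff)
  qed
  have "f x (bracket y z) = f (bracket x y) z" if x: "x \<in> extremal_set" for x y z
    by (rule linear_form_eq[OF _ _ span *[OF x]])
       (use Vector_Spaces.linear_compose[OF ad(2) lin(2)]
          Vector_Spaces.linear_compose[OF ad(1) lin(1)] in \<open>simp_all add: o_def\<close>)
  then have "f x (bracket y z) = f (bracket x y) z" for x y z
    by (rule linear_form_eq[rotated 3])
       (use span lin(1) Vector_Spaces.linear_compose[OF ad(2) lin(1)] in \<open>simp_all add: o_def\<close>)
  then show ?thesis
    by (simp add: associative_form_def)
qed

end

theorem theorem2p6:
  fixes scale :: "'k::field \<Rightarrow> 'l::ab_group_add \<Rightarrow> 'l"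
    and bracket :: "'l \<Rightarrow> 'l \<Rightarrow> 'l"
  assumes "lie_algebra scale bracket"
    and "CHAR('k) \<noteq> 2"
    and "lie_algebra.lie_generated scale bracket (lie_algebra.extremal_set scale bracket) = UNIV"
  shows "(\<exists>!f. lie_algebra.symmetric_bilinear_form scale f \<and>
            (\<forall>x \<in> lie_algebra.extremal_set scale bracket.
               lie_algebra.extremal_functional scale bracket x = (\<lambda>y. f x y))) \<and>
         (\<forall>f. lie_algebra.symmetric_bilinear_form scale f \<and>
            (\<forall>x \<in> lie_algebra.extremal_set scale bracket.
               lie_algebra.extremal_functional scale bracket x = (\<lambda>y. f x y)) \<longrightarrow>
            lie_algebra.associative_form bracket f)"
proof -
  interpret lie_algebra scale bracket
    by (rule assms(1))
  have two: "(2::'k) \<noteq> 0"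
    using assms(2) by (rule two_neq_zero_of_CHAR)
  have span: "span extremal_set = UNIV"
    using two assms(3) by (rule span_extremal_set)
  let ?P = "\<lambda>f. symmetric_bilinear_form f \<and>
    (\<forall>x\<in>extremal_set. extremal_functional x = (\<lambda>y. f x y))"
  have "\<exists>f. ?P f"
    using extremal_form_exists[OF span] by metis
  moreover have "f = g" if f: "?P f" and g: "?P g" for f g
  proof (intro ext)
    fix x y
    have "Vector_Spaces.linear scale (*) (\<lambda>x. f x y)" "Vector_Spaces.linear scale (*) (\<lambda>x. g x y)"
      using f g unfolding symmetric_bilinear_form_def bilinear_map_def by blast+
    then show "f x y = g x y"
      by (rule linear_form_eq[OF _ _ span]) (use f g in metis)
  qed
  moreover have "associative_form f" if "?P f" for f
    by (rule extremal_form_associative[OF two span]) (use that in auto)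
  ultimately show ?thesis
    by blast
qed

end
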